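(* Let $G\leq\operatorname{Aut}(T)$ act faithfully and weakly branch on a locally finite rooted tree $T$ (without leaves), and let $c\colon\partial T\times\partial T\to\mathbb N\cup\{\infty\}$, $c(\xi,\eta)=|\xi\wedge\eta|$, be the overlap function associated to $T$. Let $\alpha\in\operatorname{Aut}(G)$, acting on $\partial T$ via the canonical boundary action. Define $c^\alpha(\xi,\eta)=c(\alpha\cdot\xi,\alpha\cdot\eta)$ for $\xi,\eta\in\partial T$. Also, let $\alpha T$ denote the rooted tree $T$ equipped with the precomposed $G$-action $g\cdot_{\alpha T}v=\alpha(g)\cdot_T v$. Then the following hold. (i) The function $c^\alpha$ is a $G$-invariant admissible overlap function on $\partial T$. (ii) There is a natural $G$-equivariant isomorphism of rooted trees $\Phi_\alpha\colon T_{c^\alpha}\to\alpha T$.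
   Context: Rooted trees are locally finite and have no leaves. For a rooted tree $T$ with root $o$, $T_n$ is the set of vertices at distance $n$ from $o$, and $T_v$ is the subtree of $v$ and its descendants. $\operatorname{Aut}(T)$ is the group of graph automorphisms fixing $o$. The boundary $\partial T$ is the space of infinite non-backtracking rays from $o$, with basis of topology the cylinders (sets of rays through a given vertex). $|\xi\wedge\eta|$ is the length of the maximal common initial segment of $\xi$ and $\eta$, and $\infty$ if $\xi=\eta$. $\mathbb N$ contains $0$. $G\le\operatorname{Aut}(T)$ is weakly branch on $T$ if it is transitive on every $T_n$ and $\operatorname{Rist}_G(v)=\{g\in G:gw=w\text{ for all }w\notin T_v\}$ is nontrivial for every vertex $v$. Canonical boundary action (known theorem of Lavreniuk and Nekrashevych): if $G\le\operatorname{Aut}(T)$ is weakly branch on a locally finite rooted tree, conjugation induces an isomorphism $N_{\operatorname{Homeo}(\partial T)}(G)\cong\operatorname{Aut}(G)$; hence each $\alpha\in\operatorname{Aut}(G)$ corresponds to a unique homeomorphism $\xi\mapsto\alpha\cdot\xi$ of $\partial T$ with $\alpha\cdot(g\xi)=\alpha(g)(\alpha\cdot\xi)$ for all $g\in G$, $\xi\in\partial T$, and this is a faithful action of $\operatorname{Aut}(G)$. An overlap function on a set $X$ is a function $c\colon X\times X\to\mathbb N\cup\{\infty\}$ with $c(\xi,\xi)=\infty$, $c(\xi,\eta)=c(\eta,\xi)$, $c(\xi,\zeta)\ge\min\{c(\xi,\eta),c(\eta,\zeta)\}$; write $\xi\sim_n^c\eta\iff c(\xi,\eta)\ge n$. On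 a compact totally disconnected $X$ it is admissible if each $\sim_n^c$ has finitely many classes, all clopen, and $c(\xi,\eta)=\infty$ implies $\xi=\eta$. It is $G$-invariant if $c(g\xi,g\eta)=c(\xi,\eta)$ for all $g\in G$. For admissible $c$, $T_c$ is the rooted tree whose level-$n$ vertices are the $\sim_n^c$-classes, each level-$(n+1)$ class being adjacent to the level-$n$ class containing it; if $c$ is $G$-invariant, $G$ acts on $T_c$ by $g[\xi]_{\sim_n^c}=[g\xi]_{\sim_n^c}$. The natural map $\Phi_\alpha$ sends $[\xi]_{\sim_n^{c^\alpha}}$ to the level-$n$ vertex of $T$ on the ray $\alpha\cdot\xi$ (equivalently, to $[\alpha\cdot\xi]_{\sim_n^c}$ under the identification $T\cong T_c$). *)

theory Defs
  imports "HOL-Analysis.Analysis" "HOL-Algebra.Bij" "HOL-Library.Extended_Nat"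
begin

section \<open>Rooted trees\<close>

record 'v rtree =
  verts :: "'v set"
  adj :: "'v \<Rightarrow> 'v \<Rightarrow> bool"
  origin :: 'v

definition simple_path :: "'v rtree \<Rightarrow> 'v \<Rightarrow> 'v list \<Rightarrow> 'v \<Rightarrow> bool" where
  "simple_path T u p v \<longleftrightarrow> p \<noteq> [] \<and> hd p = u \<and> last p = v \<and> distinct p \<and>
     set p \<subseteq> verts T \<and> successively (adj T) p"

definition rooted_tree :: "'v rtree \<Rightarrow> bool" where
  "rooted_tree T \<longleftrightarrow> origin T \<in> verts T \<and>
     (\<forall>u v. adj T u v \<longrightarrow> u \<in> verts T \<and> v \<in> verts T \<and> u \<noteq> v \<and> adj T v u) \<and>
     (\<forall>u\<in>verts T. \<forall>v\<in>verts T. \<exists>!p. simple_path T u p v)"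

definition depth :: "'v rtree \<Rightarrow> 'v \<Rightarrow> nat" where
  "depth T v = (LEAST n. (adj T ^^ n) (origin T) v)"

definition level :: "'v rtree \<Rightarrow> nat \<Rightarrow> 'v set" where
  "level T n = {v \<in> verts T. depth T v = n}"

definition locally_finite :: "'v rtree \<Rightarrow> bool" where
  "locally_finite T \<longleftrightarrow> (\<forall>v\<in>verts T. finite {w. adj T v w})"

text \<open>A leaf is a vertex without children; the root may well have degree one.\<close>

definition no_leaves :: "'v rtree \<Rightarrow> bool" where
  "no_leaves T \<longleftrightarrow> (\<forall>v\<in>verts T. \<exists>w. adj T v w \<and> depth T w = Suc (depth T v))"

definition subtree_verts :: "'v rtree \<Rightarrow> 'v \<Rightarrow> 'v set" where
  "subtree_verts T v = {w. \<exists>p. simple_path T (origin T) p w \<and> v \<in> set p}"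

definition rtree_iso :: "'v rtree \<Rightarrow> 'w rtree \<Rightarrow> ('v \<Rightarrow> 'w) \<Rightarrow> bool" where
  "rtree_iso S T f \<longleftrightarrow> bij_betw f (verts S) (verts T) \<and> f (origin S) = origin T \<and>
     (\<forall>u\<in>verts S. \<forall>v\<in>verts S. adj S u v \<longleftrightarrow> adj T (f u) (f v))"


section \<open>Groups of automorphisms\<close>

text \<open>As in \<^const>\<open>BijGroup\<close>, automorphisms are extensional functions on the vertex set,
  and the product is composition.\<close>

definition aut_group :: "'v rtree \<Rightarrow> ('v \<Rightarrow> 'v) monoid" where
  "aut_group T = (BijGroup (verts T))\<lparr>carrier := {f \<in> Bij (verts T). rtree_iso T T f}\<rparr>"

definition rist :: "'v rtree \<Rightarrow> ('v \<Rightarrow> 'v) set \<Rightarrow> 'v \<Rightarrow> ('v \<Rightarrow> 'v) set" where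
  "rist T G v = {g \<in> G. \<forall>w \<in> verts T - subtree_verts T v. g w = w}"

definition weakly_branch :: "'v rtree \<Rightarrow> ('v \<Rightarrow> 'v) set \<Rightarrow> bool" where
  "weakly_branch T G \<longleftrightarrow>
     (\<forall>n. \<forall>u\<in>level T n. \<forall>v\<in>level T n. \<exists>g\<in>G. g u = v) \<and>
     (\<forall>v\<in>verts T. rist T G v \<noteq> {\<one>\<^bsub>aut_group T\<^esub>})"


section \<open>The boundary\<close>

definition boundary :: "'v rtree \<Rightarrow> (nat \<Rightarrow> 'v) set" where
  "boundary T = {\<xi>. \<xi> 0 = origin T \<and>
     (\<forall>n. adj T (\<xi> n) (\<xi> (Suc n)) \<and> \<xi> (Suc (Suc n)) \<noteq> \<xi> n)}"

definition cylinder :: "'v rtree \<Rightarrow> 'v \<Rightarrow> (nat \<Rightarrow> 'v) set" where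
  "cylinder T v = {\<xi> \<in> boundary T. v \<in> range \<xi>}"

text \<open>Two cylinders are nested or disjoint, so the cylinders, which generate this topology,
  form a base of it (together with the empty set).\<close>

definition boundary_topology :: "'v rtree \<Rightarrow> (nat \<Rightarrow> 'v) topology" where
  "boundary_topology T = topology_generated_by (cylinder T ` verts T)"

definition boundary_act :: "('v \<Rightarrow> 'v) \<Rightarrow> (nat \<Rightarrow> 'v) \<Rightarrow> (nat \<Rightarrow> 'v)" where
  "boundary_act g \<xi> = (\<lambda>n. g (\<xi> n))"

text \<open>Length is counted in edges: the common initial segment always contains the root, and two
  rays with the same vertices exactly up to level \<open>n\<close> have overlap \<open>n\<close>.\<close>

definition ray_overlap :: "(nat \<Rightarrow> 'v) \<Rightarrow> (nat \<Rightarrow> 'v) \<Rightarrow> enat" where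
  "ray_overlap \<xi> \<eta> = (if \<xi> = \<eta> then \<infinity> else enat (GREATEST n. \<forall>i\<le>n. \<xi> i = \<eta> i))"

text \<open>For a weakly branch group \<open>G\<close> and an automorphism \<open>\<alpha>\<close> of \<open>G\<close> there is, by the theorem of
  Lavreniuk and Nekrashevych, exactly one homeomorphism \<open>h\<close> of the boundary with the following
  property (as a map on the boundary), namely \<open>\<xi> \<mapsto> \<alpha> \<cdot> \<xi>\<close>.\<close>

definition canonical_boundary_homeo ::
    "'v rtree \<Rightarrow> ('v \<Rightarrow> 'v) set \<Rightarrow> (('v \<Rightarrow> 'v) \<Rightarrow> ('v \<Rightarrow> 'v)) \<Rightarrow>
     ((nat \<Rightarrow> 'v) \<Rightarrow> (nat \<Rightarrow> 'v)) \<Rightarrow> bool" where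
  "canonical_boundary_homeo T G \<alpha> h \<longleftrightarrow>
     homeomorphic_map (boundary_topology T) (boundary_topology T) h \<and>
     (\<forall>g\<in>G. \<forall>\<xi>\<in>boundary T. h (boundary_act g \<xi>) = boundary_act (\<alpha> g) (h \<xi>))"


section \<open>Overlap functions\<close>

definition overlap_function :: "'a set \<Rightarrow> ('a \<Rightarrow> 'a \<Rightarrow> enat) \<Rightarrow> bool" where
  "overlap_function X c \<longleftrightarrow>
     (\<forall>\<xi>\<in>X. c \<xi> \<xi> = \<infinity>) \<and>
     (\<forall>\<xi>\<in>X. \<forall>\<eta>\<in>X. c \<xi> \<eta> = c \<eta> \<xi>) \<and>
     (\<forall>\<xi>\<in>X. \<forall>\<eta>\<in>X. \<forall>\<zeta>\<in>X. min (c \<xi> \<eta>) (c \<eta> \<zeta>) \<le> c \<xi> \<zeta>)"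

definition overlap_rel :: "'a set \<Rightarrow> ('a \<Rightarrow> 'a \<Rightarrow> enat) \<Rightarrow> nat \<Rightarrow> ('a \<times> 'a) set" where
  "overlap_rel X c n = {(\<xi>, \<eta>) \<in> X \<times> X. enat n \<le> c \<xi> \<eta>}"

definition totally_disconnected_space :: "'a topology \<Rightarrow> bool" where
  "totally_disconnected_space X \<longleftrightarrow> (\<forall>C\<in>connected_components_of X. \<exists>x. C = {x})"

text \<open>Admissibility only makes sense on a compact totally disconnected space, so these two
  properties of the space are part of the definition.\<close>

definition admissible_overlap :: "'a topology \<Rightarrow> ('a \<Rightarrow> 'a \<Rightarrow> enat) \<Rightarrow> bool" where
  "admissible_overlap X c \<longleftrightarrow>
     compact_space X \<and> totally_disconnected_space X \<and>
     overlap_function (topspace X) c \<and>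
     (\<forall>n. finite (topspace X // overlap_rel (topspace X) c n)) \<and>
     (\<forall>n. \<forall>A \<in> topspace X // overlap_rel (topspace X) c n. openin X A \<and> closedin X A) \<and>
     (\<forall>\<xi>\<in>topspace X. \<forall>\<eta>\<in>topspace X. c \<xi> \<eta> = \<infinity> \<longrightarrow> \<xi> = \<eta>)"

definition invariant_overlap ::
    "'g set \<Rightarrow> ('g \<Rightarrow> 'a \<Rightarrow> 'a) \<Rightarrow> 'a set \<Rightarrow> ('a \<Rightarrow> 'a \<Rightarrow> enat) \<Rightarrow> bool" where
  "invariant_overlap G act X c \<longleftrightarrow>
     (\<forall>g\<in>G. \<forall>\<xi>\<in>X. \<forall>\<eta>\<in>X. c (act g \<xi>) (act g \<eta>) = c \<xi> \<eta>)"

definition pullback_overlap ::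
    "('a \<Rightarrow> 'b) \<Rightarrow> ('b \<Rightarrow> 'b \<Rightarrow> enat) \<Rightarrow> 'a \<Rightarrow> 'a \<Rightarrow> enat" where
  "pullback_overlap h c \<xi> \<eta> = c (h \<xi>) (h \<eta>)"

text \<open>Vertices of the tree of an overlap function are classes tagged with their level, since
  the same set can be a class at several levels. At level \<open>0\<close> the only class is \<open>X\<close>.\<close>

definition overlap_tree :: "'a set \<Rightarrow> ('a \<Rightarrow> 'a \<Rightarrow> enat) \<Rightarrow> (nat \<times> 'a set) rtree" where
  "overlap_tree X c =
     (let V = {(n, A). A \<in> X // overlap_rel X c n} in
      \<lparr>verts = V,
       adj = (\<lambda>(m, A) (n, B). (m, A) \<in> V \<and> (n, B) \<in> V \<and>
                (n = Suc m \<and> B \<subseteq> A \<or> m = Suc n \<and> A \<subseteq> B)),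
       origin = (0, X)\<rparr>)"

text \<open>The class of \<open>\<xi>\<close> is sent to the class of \<open>g\<xi>\<close>; when \<open>c\<close> is invariant, all sets in the
  union coincide.\<close>

definition overlap_tree_act ::
    "('g \<Rightarrow> 'a \<Rightarrow> 'a) \<Rightarrow> 'a set \<Rightarrow> ('a \<Rightarrow> 'a \<Rightarrow> enat) \<Rightarrow> 'g \<Rightarrow> nat \<times> 'a set \<Rightarrow> nat \<times> 'a set" where
  "overlap_tree_act act X c g = (\<lambda>(n, A). (n, \<Union>\<xi>\<in>A. overlap_rel X c n `` {act g \<xi>}))"


section \<open>Trees with a group action\<close>

text \<open>The action of \<open>G\<close> on \<open>\<alpha>T\<close>: elements of \<open>G\<close> are themselves maps on the vertices of \<open>T\<close>,
  so that \<open>\<alpha> g\<close> is applied to \<open>v\<close>.\<close>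

definition twisted_act :: "(('v \<Rightarrow> 'v) \<Rightarrow> ('v \<Rightarrow> 'v)) \<Rightarrow> ('v \<Rightarrow> 'v) \<Rightarrow> 'v \<Rightarrow> 'v" where
  "twisted_act \<alpha> g v = \<alpha> g v"

definition equivariant_rtree_iso ::
    "'g set \<Rightarrow> 'v rtree \<Rightarrow> ('g \<Rightarrow> 'v \<Rightarrow> 'v) \<Rightarrow> 'w rtree \<Rightarrow> ('g \<Rightarrow> 'w \<Rightarrow> 'w) \<Rightarrow> ('v \<Rightarrow> 'w) \<Rightarrow> bool" where
  "equivariant_rtree_iso G S actS T actT f \<longleftrightarrow>
     rtree_iso S T f \<and> (\<forall>g\<in>G. \<forall>v\<in>verts S. f (actS g v) = actT g (f v))"

end

(* In a tree two rays that meet at level n agree up to level n. Hence c(xi, eta) >= n says that xi and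
   eta pass through the same vertex of level n, and the classes of the pullback of c along h are the
   h-preimages of cylinders. Admissibility thus reduces to Koenig's lemma and the continuity of h, and
   sending the level-n class of xi to (h xi) n identifies the two trees. Invariance and equivariance
   follow from h (g xi) = alpha(g) (h xi). *)
theory Submission
  imports Defs
begin

section \<open>Rays in a rooted tree\<close>

lemma adjD:
  assumes "rooted_tree T" "adj T u v"
  shows "u \<in> verts T" "v \<in> verts T" "u \<noteq> v" "adj T v u"
  using assms unfolding rooted_tree_def by blast+

lemma simple_path_unique:
  assumes "rooted_tree T" "simple_path T u p v" "simple_path T u q v"
  shows "p = q"
proof -
  have "u \<in> verts T" "v \<in> verts T"
    using assms(2) unfolding simple_path_def by (metis hd_in_set last_in_set subsetD)+
  then show ?thesis
    using assms unfolding rooted_tree_def by blast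
qed

lemma simple_path_edge:
  assumes "rooted_tree T" "adj T u v"
  shows "simple_path T u [u, v] v"
  using adjD[OF assms] assms(2) by (simp add: simple_path_def)

lemma boundaryD:
  assumes "\<xi> \<in> boundary T"
  shows "\<xi> 0 = origin T" "adj T (\<xi> n) (\<xi> (Suc n))" "\<xi> (Suc (Suc n)) \<noteq> \<xi> n"
  using assms by (auto simp: boundary_def)

lemma ray_in_verts:
  assumes "rooted_tree T" "\<xi> \<in> boundary T"
  shows "\<xi> n \<in> verts T"
  using adjD[OF assms(1) boundaryD(2)[OF assms(2)]] by blast

lemma successively_map_upt:
  assumes "\<And>k. P (f k) (f (Suc k))"
  shows "successively P (map f [i..<j])"
  using assms by (auto simp: successively_conv_nth)

text \<open>Injectivity is a hypothesis because the induction in \<open>ray_inj\<close> applies this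
  to the part of the ray already known to be injective; \<open>ray_simple_path\<close> then
  discharges it.\<close>

lemma ray_segment_simple_path:
  assumes "rooted_tree T" "\<xi> \<in> boundary T" "i \<le> j" "inj_on \<xi> {..j}"
  shows "simple_path T (\<xi> i) (map \<xi> [i..<Suc j]) (\<xi> j)"
proof -
  have "inj_on \<xi> {i..<Suc j}"
    using assms(4) by (rule inj_on_subset) auto
  moreover have "hd (map \<xi> [i..<Suc j]) = \<xi> i"
    using assms(3) by (subst hd_map) (auto simp del: upt_Suc)
  ultimately show ?thesis
    using assms(3) ray_in_verts[OF assms(1,2)]
    by (auto simp: simple_path_def distinct_map last_map
        intro!: successively_map_upt boundaryD(2)[OF assms(2)] simp del: upt_Suc)
qed

text \<open>If the next vertex repeated some earlier \<open>\<xi> i\<close>, then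
  \<open>\<xi> i\<close> and \<open>\<xi> n\<close> would be adjacent. By uniqueness of paths the
  segment between them is that single edge, so the repetition would be a backtracking step, which a
  ray does not make.\<close>

lemma ray_inj:
  assumes T: "rooted_tree T" and \<xi>: "\<xi> \<in> boundary T"
  shows "inj_on \<xi> {..n}"
proof (induction n)
  case (Suc n)
  have "\<xi> (Suc n) \<noteq> \<xi> i" if i: "i \<le> n" for i
  proof
    assume eq: "\<xi> (Suc n) = \<xi> i"
    have e: "adj T (\<xi> i) (\<xi> n)"
      using adjD(4)[OF T boundaryD(2)[OF \<xi>, of n]] eq by simp
    have "map \<xi> [i..<Suc n] = [\<xi> i, \<xi> n]"
      using simple_path_unique[OF T ray_segment_simple_path[OF T \<xi> i Suc] simple_path_edge[OF T e]] .
    then have "length (map \<xi> [i..<Suc n]) = 2" by simp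
    then have "n = Suc i" using i by (simp del: upt_Suc)
    then show False using eq boundaryD(3)[OF \<xi>, of i] by simp
  qed
  then show ?case using Suc by (auto simp: atMost_Suc)
qed simp

lemma ray_simple_path:
  assumes "rooted_tree T" "\<xi> \<in> boundary T" "i \<le> j"
  shows "simple_path T (\<xi> i) (map \<xi> [i..<Suc j]) (\<xi> j)"
  using ray_segment_simple_path[OF assms ray_inj[OF assms(1,2)]] .

lemma map_upt_eqD:
  assumes "map \<xi> [0..<Suc m] = map \<eta> [0..<Suc n]"
  shows "m = n" "i \<le> n \<Longrightarrow> \<xi> i = \<eta> i"
proof -
  show "m = n"
    using arg_cong[OF assms, of length] by simp
  then show "\<xi> i = \<eta> i" if "i \<le> n"
    using that arg_cong[OF assms, of "\<lambda>p. p ! i"] by (simp add: nth_append del: upt_Suc)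
qed

text \<open>Both initial segments are simple paths from the root to the same vertex, so uniqueness
  of paths makes them the same list. Later arguments about levels and overlaps rest on this.\<close>

lemma ray_agree:
  assumes T: "rooted_tree T" and \<xi>: "\<xi> \<in> boundary T" and \<eta>: "\<eta> \<in> boundary T"
    and eq: "\<xi> m = \<eta> n"
  shows "m = n" "i \<le> n \<Longrightarrow> \<xi> i = \<eta> i"
proof -
  have "map \<xi> [0..<Suc m] = map \<eta> [0..<Suc n]"
    using simple_path_unique[OF T] ray_simple_path[OF T \<xi>, of 0 m]
      ray_simple_path[OF T \<eta>, of 0 n] eq boundaryD(1)[OF \<xi>] boundaryD(1)[OF \<eta>]
    by (metis le0)
  from map_upt_eqD[OF this] show "m = n" "i \<le> n \<Longrightarrow> \<xi> i = \<eta> i" by blast+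
qed

text \<open>This brings adjacency in \<open>T\<close> to the shape of adjacency in
  \<open>overlap_tree\<close>: consecutive levels, and agreement at the lower one.\<close>

lemma ray_adj_iff:
  assumes T: "rooted_tree T" and \<xi>: "\<xi> \<in> boundary T" and \<eta>: "\<eta> \<in> boundary T"
  shows "adj T (\<xi> m) (\<eta> n) \<longleftrightarrow> n = Suc m \<and> \<eta> m = \<xi> m \<or> m = Suc n \<and> \<xi> n = \<eta> n"
proof
  assume e: "adj T (\<xi> m) (\<eta> n)"
  show "n = Suc m \<and> \<eta> m = \<xi> m \<or> m = Suc n \<and> \<xi> n = \<eta> n"
  \<comment> \<open>If \<open>\<eta> n\<close> already lies on \<open>\<xi>\<close> up to level m,
    the edge must be the last step of that segment. Otherwise the initial segment of
    \<open>\<xi>\<close> followed by \<open>\<eta> n\<close> is a simple path from the root, hence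
    the initial segment of \<open>\<eta>\<close>.\<close>
  proof (cases "\<exists>i\<le>m. \<eta> n = \<xi> i")
    case True
    then obtain i where i: "i \<le> m" "\<xi> i = \<eta> n" by auto
    have "i = n" using ray_agree(1)[OF T \<xi> \<eta> i(2)] .
    have "adj T (\<xi> i) (\<xi> m)" using adjD(4)[OF T e] i by simp
    from simple_path_unique[OF T ray_simple_path[OF T \<xi> i(1)] simple_path_edge[OF T this]]
    have "length (map \<xi> [i..<Suc m]) = 2" by simp
    then have "m = Suc i" using i(1) by (simp del: upt_Suc)
    then show ?thesis using i \<open>i = n\<close> by simp
  next
    case False
    let ?p = "map \<xi> [0..<Suc m]"
    have p: "simple_path T (origin T) ?p (\<xi> m)"
      using ray_simple_path[OF T \<xi>, of 0 m] boundaryD(1)[OF \<xi>] by simp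
    have "simple_path T (origin T) (?p @ [\<eta> n]) (\<eta> n)"
      using p e False adjD[OF T e]
      by (auto simp: simple_path_def successively_append_iff hd_append less_Suc_eq_le
          simp del: upt_Suc)
    moreover have "simple_path T (origin T) (map \<eta> [0..<Suc n]) (\<eta> n)"
      using ray_simple_path[OF T \<eta>, of 0 n] boundaryD(1)[OF \<eta>] by simp
    ultimately have eq: "?p @ [\<eta> n] = map \<eta> [0..<Suc n]"
      by (rule simple_path_unique[OF T])
    have "n = Suc m" using arg_cong[OF eq, of length] by simp
    moreover have "\<eta> m = \<xi> m"
      using arg_cong[OF eq, of "\<lambda>p. p ! m"] \<open>n = Suc m\<close> by (simp add: nth_append del: upt_Suc)
    ultimately show ?thesis by simp
  qed
next
  assume "n = Suc m \<and> \<eta> m = \<xi> m \<or> m = Suc n \<and> \<xi> n = \<eta> n"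
  then show "adj T (\<xi> m) (\<eta> n)"
    using boundaryD(2)[OF \<eta>, of m] adjD(4)[OF T boundaryD(2)[OF \<xi>, of n]] by auto
qed

section \<open>Depth, and the existence of rays through a given vertex\<close>

lemma successively_relpowp:
  assumes "p \<noteq> []" "successively R p"
  shows "(R ^^ (length p - 1)) (hd p) (last p)"
  using assms
proof (induction p)
  case (Cons x p)
  then show ?case
    by (cases p) (auto intro: relpowp_Suc_I2 simp del: relpowp.simps(2))
qed simp

lemma depth_relpowp:
  assumes T: "rooted_tree T" and v: "v \<in> verts T"
  shows "(adj T ^^ depth T v) (origin T) v"
proof -
  obtain p where "simple_path T (origin T) p v"
    using T v unfolding rooted_tree_def by blast
  then have "(adj T ^^ (length p - 1)) (origin T) v"
    using successively_relpowp[of p "adj T"] by (auto simp: simple_path_def)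
  then show ?thesis
    unfolding depth_def by (rule LeastI)
qed

lemma depth_le:
  "(adj T ^^ n) (origin T) v \<Longrightarrow> depth T v \<le> n"
  unfolding depth_def by (rule Least_le)

text \<open>On a shortest walk to v each vertex has its index as depth: a shorter way to
  \<open>f i\<close>, continued along the walk, would reach v in fewer than \<open>depth T v\<close>
  steps.\<close>

lemma geodesic_depth:
  assumes f: "f 0 = origin T" "\<And>i. i < depth T v \<Longrightarrow> adj T (f i) (f (Suc i))" "f (depth T v) = v"
    and i: "i \<le> depth T v"
    and T: "rooted_tree T" and v: "v \<in> verts T"
  shows "depth T (f i) = i"
proof (rule antisym)
  have "(adj T ^^ i) (origin T) (f i)"
    unfolding relpowp_fun_conv using f i by (intro exI[of _ f]) auto
  then show "depth T (f i) \<le> i" by (rule depth_le)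
  have "f i \<in> verts T"
  proof (cases "i = depth T v")
    case False
    then show ?thesis using f(2)[of i] i adjD(1)[OF T] by auto
  qed (simp add: f v)
  then have "(adj T ^^ depth T (f i)) (origin T) (f i)"
    by (rule depth_relpowp[OF T])
  moreover have "(adj T ^^ (depth T v - i)) (f i) v"
    unfolding relpowp_fun_conv using f i by (intro exI[of _ "\<lambda>k. f (i + k)"]) auto
  ultimately have "(adj T ^^ (depth T (f i) + (depth T v - i))) (origin T) v"
    by (auto simp: relpowp_add)
  from depth_le[OF this] show "i \<le> depth T (f i)" using i by simp
qed

text \<open>Follow a shortest walk to v, then choose children forever. Depth equals index along the
  whole sequence, which excludes backtracking. Surjectivity of the tree isomorphism comes from
  here.\<close>

lemma ray_through_vertex:
  assumes T: "rooted_tree T" and nl: "no_leaves T" and v: "v \<in> verts T"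
  obtains \<xi> n where "\<xi> \<in> boundary T" "\<xi> n = v"
proof -
  define d where "d = depth T v"
  obtain f where f: "f 0 = origin T" "f d = v" "\<And>i. i < d \<Longrightarrow> adj T (f i) (f (Suc i))"
    using depth_relpowp[OF T v] unfolding relpowp_fun_conv d_def by blast
  define child where "child u = (SOME w. adj T u w \<and> depth T w = Suc (depth T u))" for u
  have child: "adj T u (child u) \<and> depth T (child u) = Suc (depth T u)" if "u \<in> verts T" for u
    unfolding child_def by (rule someI_ex) (use nl that in \<open>auto simp: no_leaves_def\<close>)
  have iter: "(child ^^ k) v \<in> verts T" "depth T ((child ^^ k) v) = d + k" for k
  proof (induction k)
    case (Suc k)
    show "(child ^^ Suc k) v \<in> verts T" "depth T ((child ^^ Suc k) v) = d + Suc k"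
      using child[OF Suc(1)] adjD(2)[OF T, of "(child ^^ k) v"] Suc(2) by auto
  qed (simp_all add: v d_def)
  \<comment> \<open>The two pieces fit together at index d, since \<open>f d\<close> and the zeroth
    iterate are both v.\<close>
  define \<xi> where "\<xi> n = (if n \<le> d then f n else (child ^^ (n - d)) v)" for n
  have step: "adj T (\<xi> n) (\<xi> (Suc n))" for n
  proof -
    consider "n < d" | "n = d" | "d < n" by linarith
    then show ?thesis
    proof cases
      case 3
      then show ?thesis
        using child[OF iter(1)] by (simp add: \<xi>_def Suc_diff_le)
    qed (use f child[OF v] in \<open>auto simp: \<xi>_def\<close>)
  qed
  have depth: "depth T (\<xi> n) = n" for n
  proof (cases "n \<le> d")
    case True
    then show ?thesis
      using geodesic_depth[of f T v n] f T v by (simp add: \<xi>_def d_def)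
  next
    case False
    then show ?thesis using iter(2)[of "n - d"] by (simp add: \<xi>_def)
  qed
  have "\<xi> (Suc (Suc n)) \<noteq> \<xi> n" for n
    using depth[of n] depth[of "Suc (Suc n)"] by auto
  then have "\<xi> \<in> boundary T"
    using step f(1) by (simp add: boundary_def \<xi>_def)
  moreover have "\<xi> d = v" by (simp add: \<xi>_def f)
  ultimately show thesis by (rule that)
qed

lemma finite_ray_level:
  assumes T: "rooted_tree T" and lf: "locally_finite T"
  shows "finite ((\<lambda>\<xi>. \<xi> n) ` boundary T)"
proof (induction n)
  case 0
  have "(\<lambda>\<xi>. \<xi> 0) ` boundary T \<subseteq> {origin T}" by (auto simp: boundaryD)
  then show ?case using finite_subset by blast
next
  case (Suc n)
  have "(\<lambda>\<xi>. \<xi> (Suc n)) ` boundary T \<subseteq> (\<Union>v\<in>(\<lambda>\<xi>. \<xi> n) ` boundary T. {w. adj T v w})"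
    using boundaryD(2) by fastforce
  moreover have "finite (\<Union>v\<in>(\<lambda>\<xi>. \<xi> n) ` boundary T. {w. adj T v w})"
    using lf ray_in_verts[OF T] unfolding locally_finite_def by (intro finite_UN_I[OF Suc]) blast
  ultimately show ?case by (rule finite_subset)
qed


section \<open>The boundary topology\<close>

lemma topspace_boundary [simp]:
  assumes "rooted_tree T"
  shows "topspace (boundary_topology T) = boundary T"
proof -
  have "\<xi> \<in> cylinder T (origin T)" if "\<xi> \<in> boundary T" for \<xi>
    using that boundaryD(1)[OF that] unfolding cylinder_def by (metis (mono_tags) mem_Collect_eq rangeI)
  moreover have "origin T \<in> verts T" using assms by (simp add: rooted_tree_def)
  ultimately show ?thesis
    unfolding boundary_topology_def topology_generated_by_topspace by (auto simp: cylinder_def)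
qed

text \<open>A cylinder allows its vertex to occur at any index; \<open>ray_agree\<close> forces the
  index n. From here on, cylinders are handled as sets of rays with a prescribed vertex at one
  level.\<close>

lemma cylinder_ray:
  assumes "rooted_tree T" "\<xi> \<in> boundary T"
  shows "cylinder T (\<xi> n) = {\<eta> \<in> boundary T. \<eta> n = \<xi> n}"
proof -
  have "\<eta> n = \<xi> n" if "\<eta> \<in> boundary T" "\<eta> m = \<xi> n" for \<eta> m
    using that ray_agree(1)[OF assms(1) that(1) assms(2) that(2)] by simp
  then show ?thesis
    unfolding cylinder_def by (auto intro: rangeI dest: sym)
qed

text \<open>The vertex v is arbitrary, possibly met by no ray at level n, so that the complement of
  a level class can be written as a union over all w other than v.\<close>

lemma openin_level_class:
  assumes T: "rooted_tree T"
  shows "openin (boundary_topology T) {\<eta> \<in> boundary T. \<eta> n = v}"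
proof (cases "\<exists>\<xi>\<in>boundary T. \<xi> n = v")
  case True
  then obtain \<xi> where "\<xi> \<in> boundary T" "\<xi> n = v" by blast
  then have "{\<eta> \<in> boundary T. \<eta> n = v} \<in> cylinder T ` verts T"
    using cylinder_ray[OF T, of \<xi> n] ray_in_verts[OF T, of \<xi> n] by auto
  then show ?thesis
    unfolding boundary_topology_def by (rule topology_generated_by_Basis)
next
  case False
  then have "{\<eta> \<in> boundary T. \<eta> n = v} = {}" by auto
  then show ?thesis by (metis openin_empty)
qed

lemma closedin_level_class:
  assumes T: "rooted_tree T"
  shows "closedin (boundary_topology T) {\<eta> \<in> boundary T. \<eta> n = v}"
proof -
  have "boundary T - {\<eta> \<in> boundary T. \<eta> n = v} =
      (\<Union>w\<in>- {v}. {\<eta> \<in> boundary T. \<eta> n = w})" by auto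
  then show ?thesis
    unfolding closedin_def using openin_level_class[OF T] T by auto
qed

text \<open>Induction on the generation of the open set. For an intersection the larger of the two
  levels works, because rays that meet there also agree at both smaller levels.\<close>

lemma openin_boundary_nbhd:
  assumes T: "rooted_tree T" and U: "openin (boundary_topology T) U" and \<xi>: "\<xi> \<in> U"
  obtains n where "{\<eta> \<in> boundary T. \<eta> n = \<xi> n} \<subseteq> U"
proof -
  have "generate_topology_on (cylinder T ` verts T) U"
    using U unfolding boundary_topology_def openin_topology_generated_by_iff .
  then have "\<forall>\<xi>\<in>U. \<exists>n. {\<eta> \<in> boundary T. \<eta> n = \<xi> n} \<subseteq> U"
  proof induction
    case (Int A B)
    show ?case
    proof
      fix \<xi> assume "\<xi> \<in> A \<inter> B"
      then obtain a b where ab: "{\<eta> \<in> boundary T. \<eta> a = \<xi> a} \<subseteq> A" "{\<eta> \<in> boundary T. \<eta> b = \<xi> b} \<subseteq> B"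
        and "\<xi> \<in> A \<inter> B"
        using Int by blast
      have X: "A \<subseteq> boundary T"
        using Int.hyps(1) openin_subset[of "boundary_topology T" A] topspace_boundary[OF T]
        by (simp add: boundary_topology_def openin_topology_generated_by_iff)
      have "{\<eta> \<in> boundary T. \<eta> (max a b) = \<xi> (max a b)} \<subseteq> A \<inter> B"
      proof clarify
        fix \<eta> assume *: "\<eta> \<in> boundary T" "\<eta> (max a b) = \<xi> (max a b)"
        have \<xi>: "\<xi> \<in> boundary T" using X \<open>\<xi> \<in> A \<inter> B\<close> by blast
        have "\<eta> i = \<xi> i" if "i \<le> max a b" for i
          using that by (rule ray_agree(2)[where n = "max a b", OF T *(1) \<xi> *(2)])
        then show "\<eta> \<in> A \<inter> B" using ab *(1) by auto
      qed
      then show "\<exists>n. {\<eta> \<in> boundary T. \<eta> n = \<xi> n} \<subseteq> A \<inter> B" by blast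
    qed
  next
    case (UN K)
    then show ?case by (meson Sup_upper UnionE order_trans)
  next
    case (Basis S)
    then obtain v where v: "S = cylinder T v" by blast
    show ?case
    proof
      fix \<xi> assume "\<xi> \<in> S"
      then obtain n where "\<xi> \<in> boundary T" "v = \<xi> n" by (auto simp: v cylinder_def)
      then show "\<exists>n. {\<eta> \<in> boundary T. \<eta> n = \<xi> n} \<subseteq> S"
        using cylinder_ray[OF T] v by blast
    qed
  qed simp
  with \<xi> that show thesis by blast
qed

text \<open>Koenig's lemma: without a finite subcover, classes that are not finitely covered form an
  infinite branch. This branch is a ray, and the one cover element containing it already covers one
  of those classes.\<close>

lemma compact_space_boundary:
  assumes T: "rooted_tree T" and lf: "locally_finite T"
  shows "compact_space (boundary_topology T)"
  unfolding compact_space_alt topspace_boundary[OF T]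
proof (intro allI impI, elim conjE, rule ccontr)
  fix \<U>
  assume op: "\<forall>U\<in>\<U>. openin (boundary_topology T) U" and cov: "boundary T \<subseteq> \<Union>\<U>"
    and nf: "\<nexists>\<F>. finite \<F> \<and> \<F> \<subseteq> \<U> \<and> boundary T \<subseteq> \<Union>\<F>"
  define bad where "bad n v \<longleftrightarrow>
    (\<nexists>\<F>. finite \<F> \<and> \<F> \<subseteq> \<U> \<and> {\<eta> \<in> boundary T. \<eta> n = v} \<subseteq> \<Union>\<F>)" for n v
  \<comment> \<open>A bad class is nonempty, as the empty family covers the empty set. So a bad
    vertex lies on a ray, at the stated level.\<close>
  have bad_ray: "\<exists>\<eta>\<in>boundary T. \<eta> n = v" if "bad n v" for n v
  proof (rule ccontr)
    assume "\<not> ?thesis"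
    then have "{\<eta> \<in> boundary T. \<eta> n = v} \<subseteq> \<Union>{}" by auto
    with that show False unfolding bad_def by blast
  qed
  \<comment> \<open>Every ray through v at level n continues to one of the finitely many neighbours
    of v, so finite covers for all of these would combine to one for v.\<close>
  have bad_step: "\<exists>w. adj T v w \<and> bad (Suc n) w" if b: "bad n v" for n v
  proof (rule ccontr)
    assume "\<nexists>w. adj T v w \<and> bad (Suc n) w"
    then have "\<forall>w\<in>{w. adj T v w}. \<exists>\<F>. finite \<F> \<and> \<F> \<subseteq> \<U> \<and>
        {\<eta> \<in> boundary T. \<eta> (Suc n) = w} \<subseteq> \<Union>\<F>"
      unfolding bad_def by blast
    from bchoice[OF this] obtain F where F: "\<And>w. adj T v w \<Longrightarrow> finite (F w) \<and> F w \<subseteq> \<U> \<and>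
        {\<eta> \<in> boundary T. \<eta> (Suc n) = w} \<subseteq> \<Union>(F w)"
      by auto
    have "v \<in> verts T" using bad_ray[OF b] ray_in_verts[OF T] by blast
    then have "finite (\<Union>w\<in>{w. adj T v w}. F w)"
      using lf F unfolding locally_finite_def by blast
    moreover have "(\<Union>w\<in>{w. adj T v w}. F w) \<subseteq> \<U>" using F by blast
    moreover have "{\<eta> \<in> boundary T. \<eta> n = v} \<subseteq> \<Union>(\<Union>w\<in>{w. adj T v w}. F w)"
    proof clarify
      fix \<eta> assume "\<eta> \<in> boundary T" "v = \<eta> n"
      then show "\<eta> \<in> \<Union>(\<Union>w\<in>{w. adj T (\<eta> n) w}. F w)"
        using F[of "\<eta> (Suc n)"] boundaryD(2)[of \<eta> T n] by blast
    qed
    ultimately show False using b unfolding bad_def by blast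
  qed
  have "bad 0 (origin T)"
  proof -
    have "{\<eta> \<in> boundary T. \<eta> 0 = origin T} = boundary T" by (auto simp: boundaryD)
    then show ?thesis using nf by (simp add: bad_def)
  qed
  then have "\<exists>\<xi>. \<forall>n. ((n = 0 \<longrightarrow> \<xi> n = origin T) \<and> bad n (\<xi> n)) \<and> adj T (\<xi> n) (\<xi> (Suc n))"
    by (intro dependent_nat_choice) (simp_all, meson bad_step)
  then obtain \<xi> where \<xi>: "\<xi> 0 = origin T" "\<And>n. bad n (\<xi> n)" "\<And>n. adj T (\<xi> n) (\<xi> (Suc n))"
    by auto
  \<comment> \<open>The choice only ensured adjacency, so backtracking must still be excluded: it
    would put one vertex at level n of a ray and at level n + 2 of another.\<close>
  have "\<xi> (Suc (Suc n)) \<noteq> \<xi> n" for n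
  proof
    assume eq: "\<xi> (Suc (Suc n)) = \<xi> n"
    obtain \<eta> \<zeta> where "\<eta> \<in> boundary T" "\<eta> n = \<xi> n" "\<zeta> \<in> boundary T" "\<zeta> (Suc (Suc n)) = \<xi> n"
      using bad_ray[OF \<xi>(2)] eq by metis
    then show False using ray_agree(1)[OF T, of \<eta> \<zeta> n "Suc (Suc n)"] by simp
  qed
  then have "\<xi> \<in> boundary T" using \<xi> by (simp add: boundary_def)
  then obtain U where U: "U \<in> \<U>" "\<xi> \<in> U" using cov by blast
  have "openin (boundary_topology T) U" using op U(1) by (rule bspec)
  then obtain n where "{\<eta> \<in> boundary T. \<eta> n = \<xi> n} \<subseteq> U"
    by (rule openin_boundary_nbhd[OF T _ U(2)])
  then have "finite {U} \<and> {U} \<subseteq> \<U> \<and> {\<eta> \<in> boundary T. \<eta> n = \<xi> n} \<subseteq> \<Union>{U}"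
    using U(1) by simp
  then have "\<not> bad n (\<xi> n)"
    unfolding bad_def by blast
  then show False using \<xi>(2) by blast
qed

text \<open>A connected set that meets a clopen level class is contained in it, so two rays of one
  component agree at every level.\<close>

lemma totally_disconnected_boundary:
  assumes T: "rooted_tree T"
  shows "totally_disconnected_space (boundary_topology T)"
  unfolding totally_disconnected_space_def
proof
  fix C assume C: "C \<in> connected_components_of (boundary_topology T)"
  have conn: "connectedin (boundary_topology T) C" and "C \<noteq> {}"
    using C connectedin_connected_components_of nonempty_connected_components_of by blast+
  then obtain \<xi> where \<xi>: "\<xi> \<in> C" by blast
  have "\<eta> = \<xi>" if \<eta>: "\<eta> \<in> C" for \<eta>
  proof
    fix n
    have "C \<subseteq> boundary T"
      using connectedin_subset_topspace[OF conn] T by simp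
    then have "C \<subseteq> {\<zeta> \<in> boundary T. \<zeta> n = \<xi> n} \<or> disjnt C {\<zeta> \<in> boundary T. \<zeta> n = \<xi> n}"
      using connectedin_clopen_cases[OF conn closedin_level_class[OF T] openin_level_class[OF T]]
      by blast
    then show "\<eta> n = \<xi> n"
      using \<xi> \<eta> \<open>C \<subseteq> boundary T\<close> by (auto simp: disjnt_iff)
  qed
  then show "\<exists>x. C = {x}" using \<xi> by blast
qed


section \<open>The overlap function and its pullback\<close>

text \<open>By \<open>ray_agree\<close>, agreement up to level n amounts to agreement at level n
  alone. This replaces the \<open>GREATEST\<close> in the definition by an equation between two
  vertices.\<close>

lemma enat_le_ray_overlap_iff:
  assumes T: "rooted_tree T" and \<xi>: "\<xi> \<in> boundary T" and \<eta>: "\<eta> \<in> boundary T"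
  shows "enat n \<le> ray_overlap \<xi> \<eta> \<longleftrightarrow> \<xi> n = \<eta> n"
proof (cases "\<xi> = \<eta>")
  case True
  then show ?thesis by (simp add: ray_overlap_def)
next
  case False
  then obtain m where m: "\<xi> m \<noteq> \<eta> m" by blast
  let ?P = "\<lambda>n. \<forall>i\<le>n. \<xi> i = \<eta> i"
  \<comment> \<open>\<open>GREATEST\<close> is attained only for a bounded, nonempty set of indices:
    a level m where the rays differ is a bound, and the common root gives the index 0.\<close>
  have bd: "k \<le> m" if "?P k" for k
    using that m by (meson nle_le)
  have "?P 0" using boundaryD(1)[OF \<xi>] boundaryD(1)[OF \<eta>] by simp
  then have P: "?P (Greatest ?P)" by (rule GreatestI_nat[of ?P, OF _ bd])
  have "n \<le> Greatest ?P \<longleftrightarrow> \<xi> n = \<eta> n"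
  proof
    assume "\<xi> n = \<eta> n"
    then have "?P n" using ray_agree(2)[OF T \<xi> \<eta>] by blast
    then show "n \<le> Greatest ?P" by (rule Greatest_le_nat[of ?P, OF _ bd])
  qed (use P in blast)
  then show ?thesis using False by (simp add: ray_overlap_def)
qed

lemma ray_overlap_eq_infinity_iff: "ray_overlap \<xi> \<eta> = \<infinity> \<longleftrightarrow> \<xi> = \<eta>"
  by (simp add: ray_overlap_def)

lemma ray_overlap_commute: "ray_overlap \<xi> \<eta> = ray_overlap \<eta> \<xi>"
  by (simp add: ray_overlap_def eq_commute)

lemma enat_le_cofinal:
  assumes "\<And>n. enat n \<le> a \<Longrightarrow> enat n \<le> b"
  shows "a \<le> b"
proof (cases b)
  case (enat k)
  \<comment> \<open>The test value k + 1 rules out that a is infinite.\<close>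
  then show ?thesis using assms[of "Suc k"] by (cases a) (use assms in auto)
qed simp

text \<open>Tested against each finite n, the ultrametric inequality becomes transitivity of having
  equal vertices at level n.\<close>

lemma overlap_function_pullback:
  assumes T: "rooted_tree T" and h: "h ` X \<subseteq> boundary T"
  shows "overlap_function X (pullback_overlap h ray_overlap)"
proof -
  have "min (ray_overlap (h \<xi>) (h \<eta>)) (ray_overlap (h \<eta>) (h \<zeta>)) \<le> ray_overlap (h \<xi>) (h \<zeta>)"
    if "\<xi> \<in> X" "\<eta> \<in> X" "\<zeta> \<in> X" for \<xi> \<eta> \<zeta>
  proof (rule enat_le_cofinal)
    have "h \<xi> \<in> boundary T" "h \<eta> \<in> boundary T" "h \<zeta> \<in> boundary T" using that h by auto
    then show "enat n \<le> min (ray_overlap (h \<xi>) (h \<eta>)) (ray_overlap (h \<eta>) (h \<zeta>)) \<Longrightarrow>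
        enat n \<le> ray_overlap (h \<xi>) (h \<zeta>)" for n
      by (simp add: enat_le_ray_overlap_iff[OF T])
  qed
  then show ?thesis
    unfolding overlap_function_def pullback_overlap_def
    using ray_overlap_commute by (auto simp: ray_overlap_eq_infinity_iff)
qed

lemma overlap_rel_pullback:
  assumes "rooted_tree T" "h ` X \<subseteq> boundary T"
  shows "overlap_rel X (pullback_overlap h ray_overlap) n = {(\<xi>, \<eta>) \<in> X \<times> X. h \<xi> n = h \<eta> n}"
  using assms(2)
  by (auto simp: overlap_rel_def pullback_overlap_def image_subset_iff
      enat_le_ray_overlap_iff[OF assms(1)])

lemma overlap_class_pullback:
  assumes "rooted_tree T" "h ` X \<subseteq> boundary T" "\<xi> \<in> X"
  shows "overlap_rel X (pullback_overlap h ray_overlap) n `` {\<xi>} = {\<eta> \<in> X. h \<eta> n = h \<xi> n}"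
  using assms(3) by (auto simp: overlap_rel_pullback[OF assms(1,2)])

text \<open>The classes are h-preimages of level classes: finite in number since each level is
  finite, clopen since h is continuous. Injectivity of h gives separation of points.\<close>

lemma admissible_pullback:
  assumes T: "rooted_tree T" and lf: "locally_finite T"
    and h: "homeomorphic_map (boundary_topology T) (boundary_topology T) h"
  shows "admissible_overlap (boundary_topology T) (pullback_overlap h ray_overlap)"
proof -
  have cont: "continuous_map (boundary_topology T) (boundary_topology T) h"
    using h by (rule homeomorphic_imp_continuous_map)
  have im: "h ` boundary T \<subseteq> boundary T" and inj: "inj_on h (boundary T)"
    using homeomorphic_imp_surjective_map[OF h] homeomorphic_imp_injective_map[OF h] T by simp_all
  let ?R = "overlap_rel (boundary T) (pullback_overlap h ray_overlap)"
  have cls: "\<exists>\<xi>\<in>boundary T. A = {\<eta> \<in> boundary T. h \<eta> n = h \<xi> n}"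
    if "A \<in> boundary T // ?R n" for A n
    using that overlap_class_pullback[OF T im] by (auto simp: quotient_def)
  have "finite (boundary T // ?R n)" for n
  proof -
    have "boundary T // ?R n \<subseteq> (\<lambda>v. {\<eta> \<in> boundary T. h \<eta> n = v}) ` (\<lambda>\<xi>. \<xi> n) ` boundary T"
      using cls im by fastforce
    then show ?thesis using finite_ray_level[OF T lf] finite_subset by blast
  qed
  moreover have "openin (boundary_topology T) A \<and> closedin (boundary_topology T) A"
    if A: "A \<in> boundary T // ?R n" for A n
  proof -
    obtain \<xi> where "A = {\<eta> \<in> boundary T. h \<eta> n = h \<xi> n}"
      using cls[OF A] by blast
    also have "\<dots> = {\<eta> \<in> topspace (boundary_topology T). h \<eta> \<in> {\<zeta> \<in> boundary T. \<zeta> n = h \<xi> n}}"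
      using im T by auto
    finally show ?thesis
      using openin_continuous_map_preimage[OF cont openin_level_class[OF T]]
        closedin_continuous_map_preimage[OF cont closedin_level_class[OF T]] by simp
  qed
  ultimately show ?thesis
    using compact_space_boundary[OF T lf] totally_disconnected_boundary[OF T]
      overlap_function_pullback[OF T im] inj T
    by (auto simp: admissible_overlap_def pullback_overlap_def ray_overlap_eq_infinity_iff
        dest: inj_onD)
qed

text \<open>Injectivity comes from \<open>ray_agree\<close>, surjectivity from a ray through each
  vertex together with surjectivity of h, and adjacency from \<open>ray_adj_iff\<close>. The map
  enters only through its values on classes, so any choice of representatives may define it.\<close>

lemma overlap_tree_pullback_iso:
  assumes T: "rooted_tree T" and nl: "no_leaves T"
    and im: "h ` X = boundary T"
    and R: "R = overlap_rel X (pullback_overlap h ray_overlap)"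
    and \<Phi>: "\<And>n \<xi>. \<xi> \<in> X \<Longrightarrow> \<Phi> (n, R n `` {\<xi>}) = h \<xi> n"
  shows "rtree_iso (overlap_tree X (pullback_overlap h ray_overlap)) T \<Phi>"
proof -
  let ?S = "overlap_tree X (pullback_overlap h ray_overlap)"
  have im': "h ` X \<subseteq> boundary T" and hb: "\<And>\<xi>. \<xi> \<in> X \<Longrightarrow> h \<xi> \<in> boundary T"
    using im by auto
  have surj: "\<exists>\<xi>\<in>X. h \<xi> = \<rho>" if "\<rho> \<in> boundary T" for \<rho>
    using that unfolding im[symmetric] by blast
  have cls: "R n `` {\<xi>} = {\<eta> \<in> X. h \<eta> n = h \<xi> n}" if "\<xi> \<in> X" for n \<xi>
    unfolding R by (rule overlap_class_pullback[OF T im' that])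
  have verts: "verts ?S = {(n, R n `` {\<xi>}) |n \<xi>. \<xi> \<in> X}"
    by (auto simp: overlap_tree_def R quotient_def)
  have root: "origin T \<in> verts T" using T by (simp add: rooted_tree_def)
  have "inj_on \<Phi> (verts ?S)"
  proof (rule inj_onI)
    fix a b assume "a \<in> verts ?S" "b \<in> verts ?S" and eq: "\<Phi> a = \<Phi> b"
    then obtain m n \<xi> \<eta> where ab: "a = (m, R m `` {\<xi>})" "b = (n, R n `` {\<eta>})" "\<xi> \<in> X" "\<eta> \<in> X"
      unfolding verts by blast
    then have "h \<xi> m = h \<eta> n" using eq \<Phi> by simp
    \<comment> \<open>The vertices of the overlap tree carry their level as a tag, so equal images
      must also force equal levels.\<close>
    moreover from this have "m = n" using ray_agree(1)[OF T hb hb] ab by blast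
    ultimately show "a = b" using ab cls by simp
  qed
  moreover have "\<Phi> ` verts ?S = verts T"
  proof
    show "\<Phi> ` verts ?S \<subseteq> verts T"
      using ray_in_verts[OF T hb] by (auto simp: verts \<Phi>)
    show "verts T \<subseteq> \<Phi> ` verts ?S"
    proof
      fix v assume "v \<in> verts T"
      then obtain \<rho> n where "\<rho> \<in> boundary T" "\<rho> n = v" by (rule ray_through_vertex[OF T nl])
      then obtain \<xi> where "\<xi> \<in> X" "h \<xi> n = v" using surj by blast
      then have "(n, R n `` {\<xi>}) \<in> verts ?S" "\<Phi> (n, R n `` {\<xi>}) = v" using \<Phi> verts by auto
      then show "v \<in> \<Phi> ` verts ?S" by blast
    qed
  qed
  moreover have "\<Phi> (origin ?S) = origin T"
  proof -
    \<comment> \<open>Some ray is needed to see X as a class: all images under h start at the root,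
      so the level-0 class of any point is all of X.\<close>
    obtain \<rho> n where "\<rho> \<in> boundary T" "\<rho> n = origin T"
      by (rule ray_through_vertex[OF T nl root])
    then obtain \<xi> where \<xi>: "\<xi> \<in> X" using surj by blast
    have "h \<eta> 0 = origin T" if "\<eta> \<in> X" for \<eta> using boundaryD(1)[OF hb[OF that]] .
    then have "X = R 0 `` {\<xi>}" "h \<xi> 0 = origin T" using cls[OF \<xi>] \<xi> by auto
    then show ?thesis using \<Phi>[OF \<xi>, of 0] by (simp add: overlap_tree_def)
  qed
  moreover have "adj ?S a b \<longleftrightarrow> adj T (\<Phi> a) (\<Phi> b)" if V: "a \<in> verts ?S" "b \<in> verts ?S" for a b
  proof -
    obtain m n \<xi> \<eta> where ab: "a = (m, R m `` {\<xi>})" "b = (n, R n `` {\<eta>})" "\<xi> \<in> X" "\<eta> \<in> X"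
      using V unfolding verts by blast
    \<comment> \<open>Inclusion of a class in one a level lower only tests agreement at the lower
      level, because agreement at level k + 1 implies agreement at level k.\<close>
    have sub: "R (Suc k) `` {\<beta>} \<subseteq> R k `` {\<gamma>} \<longleftrightarrow> h \<beta> k = h \<gamma> k" if "\<beta> \<in> X" "\<gamma> \<in> X" for k \<beta> \<gamma>
    proof
      assume "h \<beta> k = h \<gamma> k"
      moreover have "h \<delta> k = h \<beta> k" if "\<delta> \<in> X" "h \<delta> (Suc k) = h \<beta> (Suc k)" for \<delta>
        using ray_agree(2)[OF T hb[OF that(1)] hb[OF \<open>\<beta> \<in> X\<close>] that(2), of k] by simp
      ultimately show "R (Suc k) `` {\<beta>} \<subseteq> R k `` {\<gamma>}"
        unfolding cls[OF that(1)] cls[OF that(2)] by simp blast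
    qed (use that in \<open>auto simp: cls[OF that(1)] cls[OF that(2)]\<close>)
    have "adj ?S a b \<longleftrightarrow> n = Suc m \<and> R n `` {\<eta>} \<subseteq> R m `` {\<xi>} \<or> m = Suc n \<and> R m `` {\<xi>} \<subseteq> R n `` {\<eta>}"
      using V unfolding ab by (simp add: overlap_tree_def Let_def)
    also have "\<dots> \<longleftrightarrow> n = Suc m \<and> h \<eta> m = h \<xi> m \<or> m = Suc n \<and> h \<xi> n = h \<eta> n"
      by (metis sub ab(3,4))
    also have "\<dots> \<longleftrightarrow> adj T (\<Phi> a) (\<Phi> b)"
      using ray_adj_iff[OF T hb hb] ab \<Phi> by simp
    finally show ?thesis .
  qed
  ultimately show ?thesis by (simp add: rtree_iso_def bij_betw_def)
qed


section \<open>Group actions\<close>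

lemma aut_group_rtree_iso:
  assumes "subgroup G (aut_group T)" "g \<in> G"
  shows "rtree_iso T T g"
  using subgroup.mem_carrier[OF assms] by (simp add: aut_group_def)

lemma boundary_act_in_boundary:
  assumes T: "rooted_tree T" and g: "rtree_iso T T g" and \<xi>: "\<xi> \<in> boundary T"
  shows "boundary_act g \<xi> \<in> boundary T"
  using g boundaryD[OF \<xi>] ray_in_verts[OF T \<xi>]
  by (auto simp: boundary_def boundary_act_def rtree_iso_def bij_betw_def dest: inj_onD)

lemma ray_overlap_boundary_act:
  assumes T: "rooted_tree T" and g: "rtree_iso T T g" and "\<xi> \<in> boundary T" "\<eta> \<in> boundary T"
  shows "ray_overlap (boundary_act g \<xi>) (boundary_act g \<eta>) = ray_overlap \<xi> \<eta>"
proof -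
  have "g (\<xi> n) = g (\<eta> n) \<longleftrightarrow> \<xi> n = \<eta> n" for n
    using g ray_in_verts[OF T] assms(3,4) by (metis rtree_iso_def bij_betw_def inj_on_eq_iff)
  then show ?thesis
    by (simp add: ray_overlap_def boundary_act_def fun_eq_iff)
qed

lemma auto_closed:
  assumes "\<alpha> \<in> auto (H\<lparr>carrier := G\<rparr>)" "g \<in> G"
  shows "\<alpha> g \<in> G"
  using assms by (auto simp: auto_def hom_def)

theorem proposition5p1:
  fixes T :: "'v rtree"
    and G :: "('v \<Rightarrow> 'v) set"
    and \<alpha> :: "('v \<Rightarrow> 'v) \<Rightarrow> ('v \<Rightarrow> 'v)"
    and h :: "(nat \<Rightarrow> 'v) \<Rightarrow> (nat \<Rightarrow> 'v)"
    and c c\<alpha> :: "(nat \<Rightarrow> 'v) \<Rightarrow> (nat \<Rightarrow> 'v) \<Rightarrow> enat"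
  assumes "rooted_tree T" and "locally_finite T" and "no_leaves T"
    and "subgroup G (aut_group T)"
    and "weakly_branch T G"
    and "\<alpha> \<in> auto ((aut_group T)\<lparr>carrier := G\<rparr>)"
    and "canonical_boundary_homeo T G \<alpha> h"
    and "c = ray_overlap"
    and "c\<alpha> = pullback_overlap h c"
  shows "(invariant_overlap G boundary_act (boundary T) c\<alpha> \<and>
          admissible_overlap (boundary_topology T) c\<alpha>) \<and>
         (\<exists>\<Phi>. equivariant_rtree_iso G
                (overlap_tree (boundary T) c\<alpha>) (overlap_tree_act boundary_act (boundary T) c\<alpha>)
                T (twisted_act \<alpha>) \<Phi> \<and>
              (\<forall>n. \<forall>\<xi>\<in>boundary T. \<Phi> (n, overlap_rel (boundary T) c\<alpha> n `` {\<xi>}) = h \<xi> n))"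
proof -
  note T = assms(1)
  let ?X = "boundary T"
  have c\<alpha>: "c\<alpha> = pullback_overlap h ray_overlap" using assms(8,9) by simp
  have homeo: "homeomorphic_map (boundary_topology T) (boundary_topology T) h"
    and equi: "\<And>g \<xi>. g \<in> G \<Longrightarrow> \<xi> \<in> ?X \<Longrightarrow> h (boundary_act g \<xi>) = boundary_act (\<alpha> g) (h \<xi>)"
    using assms(7) by (auto simp: canonical_boundary_homeo_def)
  have im: "h ` ?X = ?X" using homeomorphic_imp_surjective_map[OF homeo] T by simp
  then have im': "h ` ?X \<subseteq> ?X" and hb: "\<And>\<xi>. \<xi> \<in> ?X \<Longrightarrow> h \<xi> \<in> ?X" by auto
  have iso: "rtree_iso T T g" "rtree_iso T T (\<alpha> g)" if "g \<in> G" for g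
    using that auto_closed[OF assms(6)] aut_group_rtree_iso[OF assms(4)] by blast+
  have act: "boundary_act g \<xi> \<in> ?X" if "g \<in> G" "\<xi> \<in> ?X" for g \<xi>
    using boundary_act_in_boundary[OF T iso(1)] that by blast
  define R where "R = overlap_rel ?X c\<alpha>"
  have cls: "R n `` {\<xi>} = {\<eta> \<in> ?X. h \<eta> n = h \<xi> n}" if "\<xi> \<in> ?X" for n \<xi>
    unfolding R_def c\<alpha> by (rule overlap_class_pullback[OF T im' that])
  \<comment> \<open>A class has no preferred element, so one is chosen; the value does not depend on
    it, since \<open>h \<eta> n\<close> is constant on a class of level n.\<close>
  define \<Phi> where "\<Phi> = (\<lambda>(n, A). h (SOME \<xi>. \<xi> \<in> A) n)"
  have \<Phi>: "\<Phi> (n, R n `` {\<xi>}) = h \<xi> n" if "\<xi> \<in> ?X" for n \<xi>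
    unfolding \<Phi>_def cls[OF that] prod.case by (rule someI2[of _ \<xi>]) (use that in auto)
  \<comment> \<open>Conjugation by h turns the action of g into that of \<open>\<alpha> g\<close>,
    again a tree automorphism, and those preserve the overlap of rays.\<close>
  have "invariant_overlap G boundary_act ?X c\<alpha>"
    using ray_overlap_boundary_act[OF T iso(2) hb hb] equi
    by (simp add: invariant_overlap_def c\<alpha> pullback_overlap_def)
  moreover have "admissible_overlap (boundary_topology T) c\<alpha>"
    unfolding c\<alpha> by (rule admissible_pullback[OF T assms(2) homeo])
  moreover have "rtree_iso (overlap_tree ?X c\<alpha>) T \<Phi>"
    unfolding c\<alpha> using overlap_tree_pullback_iso[OF T assms(3) im _ \<Phi>] R_def c\<alpha> by blast
  moreover have "\<Phi> (overlap_tree_act boundary_act ?X c\<alpha> g v) = twisted_act \<alpha> g (\<Phi> v)"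
    if g: "g \<in> G" and v: "v \<in> verts (overlap_tree ?X c\<alpha>)" for g v
  proof -
    obtain n \<xi> where v_eq: "v = (n, R n `` {\<xi>})" and \<xi>: "\<xi> \<in> ?X"
      using v by (auto simp: overlap_tree_def R_def quotient_def)
    \<comment> \<open>The level-n vertex of \<open>h (boundary_act g \<eta>)\<close> is
      \<open>\<alpha> g\<close> applied to \<open>h \<eta> n\<close>, hence depends only on the
      class of \<open>\<eta>\<close>. So all sets in the union defining the action coincide.\<close>
    have "R n `` {boundary_act g \<eta>} = R n `` {boundary_act g \<xi>}" if "\<eta> \<in> R n `` {\<xi>}" for \<eta>
    proof -
      have "\<eta> \<in> ?X" "h \<eta> n = h \<xi> n" using that cls[OF \<xi>] by auto
      then show ?thesis
        using cls act[OF g] equi[OF g] \<xi> by (simp add: boundary_act_def[of "\<alpha> g"])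
    qed
    moreover have "\<xi> \<in> R n `` {\<xi>}" using cls[OF \<xi>] \<xi> by simp
    ultimately have "overlap_tree_act boundary_act ?X c\<alpha> g v = (n, R n `` {boundary_act g \<xi>})"
      unfolding overlap_tree_act_def v_eq prod.case R_def[symmetric] by blast
    then show ?thesis
      using \<Phi>[OF act[OF g \<xi>]] \<Phi>[OF \<xi>] equi[OF g \<xi>]
      by (simp add: v_eq twisted_act_def boundary_act_def[of "\<alpha> g"])
  qed
  ultimately show ?thesis
    using \<Phi> unfolding equivariant_rtree_iso_def R_def by blast
qed

end
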